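(* Let $\succsim$ be a CRDU preference relation on $\mathcal X$. If $\succsim$ satisfies Property (SRA) and the $\succsim$-matching probability is supermodular, then $\succsim$ satisfies Property (DS).
   Context: Setting. $(\Omega,\mathcal F)$ is a measurable space, $\mathcal G\subseteq\mathcal F$ is a sub-$\sigma$-algebra, and $\mathbb P:\mathcal G\to[0,1]$ is a (countably additive) probability measure that is atomless: $\{\mathbb P(B):B\in\mathcal G,\,B\subseteq A\}=[0,\mathbb P(A)]$ for every $A\in\mathcal G$. An act is a bounded $\mathcal F$-measurable function $X:\Omega\to\mathbb R$; $\mathcal X$ is the set of acts, $\mathcal X(\mathcal G)$ the set of $\mathcal G$-measurable acts. A preference relation $\succsim$ is a total preorder on $\mathcal X$; $\succ$ and $\simeq$ are its strict and symmetric parts. For $A,B\in\mathcal F$, $A\simeq B$ means $\mathbf 1_A\simeq\mathbf 1_B$. A capacity is $\nu:\mathcal F\to\mathbb R$ with $\nu(\varnothing)=0$, $\nu(\Omega)=1$, and $\nu(A)\le\nu(B)$ whenever $A\subseteq B$. It is continuous if $\nu(A_n)\to\nu(\bigcup_n A_n)$ for increasing sequences and $\nu(A_n)\to\nu(\bigcap_n A_n)$ for decreasing sequences. It is risk conforming if $\nu|_{\mathcal G}=\mathbb P$. It is supermodular if $\nu(A)+\nu(B)\le\nu(A\cup B)+\nu(A\cap B)$ for all $A,B\in\mathcal F$. A distortion function is an increasing $g:[0,1]\to[0,1]$ with $g(0)=0$, $g(1)=1$. The Choquet integral is $\int X\,\mathrm d\nu=\int_0^\infty\nu(X>x)\,\mathrm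 dx+\int_{-\infty}^0(\nu(X>x)-1)\,\mathrm dx$. A preference relation $\succsim$ is a CRDU preference relation if there are a continuous strictly increasing $u:\mathbb R\to\mathbb R$, a continuous strictly increasing distortion function $g$, and a continuous risk-conforming capacity $\nu$ such that $X\succsim Y\iff\int u(X)\,\mathrm d(g\circ\nu)\ge\int u(Y)\,\mathrm d(g\circ\nu)$ for all $X,Y\in\mathcal X$. A $\succsim$-matching probability is a function $\nu:\mathcal F\to[0,1]$ such that for every $A\in\mathcal F$ there is $R_A\in\mathcal G$ with $\nu(A)=\mathbb P(R_A)$ and $A\simeq R_A$. For a CRDU preference relation it exists, is unique, and equals the capacity $\nu$ in the representation. Property (SRA), strong risk aversion: for all $X,Y\in\mathcal X(\mathcal G)$ such that $\int_\Omega f(X)\,\mathrm d\mathbb P\ge\int_\Omega f(Y)\,\mathrm d\mathbb P$ for every increasing concave $f:\mathbb R\to\mathbb R$, one has $X\succsim Y$. Property (DS), diversification seeking: for all $X,Y\in\mathcal X$ with $X\simeq Y$ and all $\lambda\in[0,1]$, $\lambda X+(1-\lambda)Y\succsim X$. *)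

theory Defs
  imports "HOL-Probability.Probability"
begin

(* The measurable space (Omega, F) is represented by a measure F of which only
   space F and sets F are used; the probability space (Omega, G, P) is represented
   by a measure P with "subalgebra F P", so that G is sets P. *)

definition atomless :: "'a measure \<Rightarrow> bool" where
  "atomless P \<longleftrightarrow> (\<forall>A\<in>sets P. measure P ` {B \<in> sets P. B \<subseteq> A} = {0..measure P A})"

definition acts :: "'a measure \<Rightarrow> ('a \<Rightarrow> real) set" where
  "acts F = {X \<in> borel_measurable F. bounded (X ` space F)}"

definition preference_relation ::
    "'a measure \<Rightarrow> (('a \<Rightarrow> real) \<Rightarrow> ('a \<Rightarrow> real) \<Rightarrow> bool) \<Rightarrow> bool" where
  "preference_relation F R \<longleftrightarrow>
     reflp_on (acts F) R \<and> transp_on (acts F) R \<and> totalp_on (acts F) R"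

definition indifferent ::
    "(('a \<Rightarrow> real) \<Rightarrow> ('a \<Rightarrow> real) \<Rightarrow> bool) \<Rightarrow> ('a \<Rightarrow> real) \<Rightarrow> ('a \<Rightarrow> real) \<Rightarrow> bool" where
  "indifferent R X Y \<longleftrightarrow> R X Y \<and> R Y X"

definition capacity :: "'a measure \<Rightarrow> ('a set \<Rightarrow> real) \<Rightarrow> bool" where
  "capacity F \<nu> \<longleftrightarrow> \<nu> {} = 0 \<and> \<nu> (space F) = 1 \<and>
     (\<forall>A\<in>sets F. \<forall>B\<in>sets F. A \<subseteq> B \<longrightarrow> \<nu> A \<le> \<nu> B)"

definition continuous_capacity :: "'a measure \<Rightarrow> ('a set \<Rightarrow> real) \<Rightarrow> bool" where
  "continuous_capacity F \<nu> \<longleftrightarrow> capacity F \<nu> \<and>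
     (\<forall>A :: nat \<Rightarrow> 'a set. range A \<subseteq> sets F \<longrightarrow> incseq A \<longrightarrow>
        (\<lambda>n. \<nu> (A n)) \<longlonglongrightarrow> \<nu> (\<Union>n. A n)) \<and>
     (\<forall>A :: nat \<Rightarrow> 'a set. range A \<subseteq> sets F \<longrightarrow> decseq A \<longrightarrow>
        (\<lambda>n. \<nu> (A n)) \<longlonglongrightarrow> \<nu> (\<Inter>n. A n))"

definition risk_conforming :: "'a measure \<Rightarrow> ('a set \<Rightarrow> real) \<Rightarrow> bool" where
  "risk_conforming P \<nu> \<longleftrightarrow> (\<forall>A\<in>sets P. \<nu> A = measure P A)"

definition supermodular :: "'a measure \<Rightarrow> ('a set \<Rightarrow> real) \<Rightarrow> bool" where
  "supermodular F \<nu> \<longleftrightarrow>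
     (\<forall>A\<in>sets F. \<forall>B\<in>sets F. \<nu> A + \<nu> B \<le> \<nu> (A \<union> B) + \<nu> (A \<inter> B))"

(* Distortion functions live on [0,1]; their values elsewhere are irrelevant. *)
definition distortion_function :: "(real \<Rightarrow> real) \<Rightarrow> bool" where
  "distortion_function g \<longleftrightarrow>
     g \<in> {0..1} \<rightarrow> {0..1} \<and> mono_on {0..1} g \<and> g 0 = 0 \<and> g 1 = 1"

(* For bounded measurable X and a capacity, both integrands are monotone and vanish
   outside a bounded interval, so the Lebesgue integrals below always exist. *)
definition choquet_integral :: "'a measure \<Rightarrow> ('a set \<Rightarrow> real) \<Rightarrow> ('a \<Rightarrow> real) \<Rightarrow> real" where
  "choquet_integral F \<nu> X =
     (LBINT x:{0..}. \<nu> {\<omega> \<in> space F. X \<omega> > x}) +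
     (LBINT x:{..0}. (\<nu> {\<omega> \<in> space F. X \<omega> > x} - 1))"

definition CRDU_preference ::
    "'a measure \<Rightarrow> 'a measure \<Rightarrow> (('a \<Rightarrow> real) \<Rightarrow> ('a \<Rightarrow> real) \<Rightarrow> bool) \<Rightarrow> bool" where
  "CRDU_preference F P R \<longleftrightarrow> preference_relation F R \<and>
     (\<exists>u g \<nu>. continuous_on UNIV u \<and> strict_mono u \<and>
        distortion_function g \<and> continuous_on {0..1} g \<and> strict_mono_on {0..1} g \<and>
        continuous_capacity F \<nu> \<and> risk_conforming P \<nu> \<and>
        (\<forall>X\<in>acts F. \<forall>Y\<in>acts F. R X Y \<longleftrightarrow>
           choquet_integral F (g \<circ> \<nu>) (u \<circ> X) \<ge> choquet_integral F (g \<circ> \<nu>) (u \<circ> Y)))"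

definition matching_probability ::
    "'a measure \<Rightarrow> 'a measure \<Rightarrow> (('a \<Rightarrow> real) \<Rightarrow> ('a \<Rightarrow> real) \<Rightarrow> bool) \<Rightarrow>
     ('a set \<Rightarrow> real) \<Rightarrow> bool" where
  "matching_probability F P R \<nu> \<longleftrightarrow> \<nu> \<in> sets F \<rightarrow> {0..1} \<and>
     (\<forall>A\<in>sets F. \<exists>B\<in>sets P. \<nu> A = measure P B \<and>
        indifferent R (indicator A) (indicator B))"

definition strong_risk_averse ::
    "'a measure \<Rightarrow> (('a \<Rightarrow> real) \<Rightarrow> ('a \<Rightarrow> real) \<Rightarrow> bool) \<Rightarrow> bool" where
  "strong_risk_averse P R \<longleftrightarrow> (\<forall>X\<in>acts P. \<forall>Y\<in>acts P.
     (\<forall>f :: real \<Rightarrow> real. mono f \<and> concave_on UNIV f \<longrightarrow>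
        (\<integral>\<omega>. f (X \<omega>) \<partial>P) \<ge> (\<integral>\<omega>. f (Y \<omega>) \<partial>P)) \<longrightarrow> R X Y)"

definition diversification_seeking ::
    "'a measure \<Rightarrow> (('a \<Rightarrow> real) \<Rightarrow> ('a \<Rightarrow> real) \<Rightarrow> bool) \<Rightarrow> bool" where
  "diversification_seeking F R \<longleftrightarrow> (\<forall>X\<in>acts F. \<forall>Y\<in>acts F. \<forall>c\<in>{0..1}.
     indifferent R X Y \<longrightarrow> R (\<lambda>\<omega>. c * X \<omega> + (1 - c) * Y \<omega>) X)"

end

theory Submission
  imports Defs
begin

text \<open>Applied to three-outcome risks, strong risk aversion says that the increment ratios
  \<open>(u x - u (x - d)) / (u (x + d) - u x)\<close> and \<open>(g (p + q) - g p) / (g p - g (p - q))\<close> always have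
  product at least one. Neither ratio can be bounded below by a constant above one, because halving
  the step squares such a bound; hence both are at least one everywhere.
  So \<open>u\<close> is midpoint concave
  and \<open>g\<close> is midpoint convex, and continuity gives concavity and convexity. A convex increasing
  transformation of a supermodular capacity is supermodular, and the Choquet integral for a
  supermodular set function is superadditive; together with the concavity of \<open>u\<close> this makes the
  representing functional concave. The matching probability is the capacity of the representation
  because \<open>g\<close> is injective.\<close>

section \<open>Increment ratios and midpoint convexity of real functions\<close>

text \<open>Otherwise every left increment is at least \<open>K ^ 2 ^ n\<close> times the right one,
  for all \<open>n\<close>. At the midpoint of \<open>{a..b}\<close> the right increment is
  positive, so the ratio there is one finite number, which these powers exceed.\<close>

lemma small_increment_ratio:
  fixes f :: "real \<Rightarrow> real"
  assumes f: "strict_mono_on {a..b} f" and "a < b" and "1 < K"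
  shows "\<exists>x d. 0 < d \<and> a \<le> x - d \<and> x + d \<le> b \<and> f x - f (x - d) < K * (f (x + d) - f x)"
proof (rule ccontr)
  assume "\<not> ?thesis"
  then have ratio: "f x - f (x - d) \<ge> K * (f (x + d) - f x)"
    if "0 < d" "a \<le> x - d" "x + d \<le> b" for x d
    using that by force
  \<comment> \<open>Halving the step squares the ratio.\<close>
  have iter: "f x - f (x - d) \<ge> K ^ 2 ^ n * (f (x + d) - f x)"
    if "0 < d" "a \<le> x - d" "x + d \<le> b" for x d n
    using that
  proof (induction n arbitrary: x d)
    case 0
    then show ?case using ratio by simp
  next
    case (Suc n)
    define L where "L = K ^ 2 ^ n"
    have L: "L \<ge> 0" using \<open>1 < K\<close> by (simp add: L_def)
    have 1: "f (x - d/2) - f (x - d) \<ge> L * (f x - f (x - d/2))"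
      using Suc.IH[of "d/2" "x - d/2"] Suc.prems by (simp add: L_def)
    have 2: "f x - f (x - d/2) \<ge> L * (f (x + d/2) - f x)"
      using Suc.IH[of "d/2" "x"] Suc.prems by (simp add: L_def)
    have 3: "f (x + d/2) - f x \<ge> L * (f (x + d) - f (x + d/2))"
      using Suc.IH[of "d/2" "x + d/2"] Suc.prems by (simp add: L_def add.commute)
    \<comment> \<open>Steps of length \<open>d/2\<close> cut the interval into quarters, each
      increment being at least \<open>L\<close> times the next. So the first is at least
      \<open>L * L\<close> times the third and the second \<open>L * L\<close> times the fourth;
      adding gives the claim for \<open>d\<close>.\<close>
    have "f (x - d/2) - f (x - d) \<ge> L * (L * (f (x + d/2) - f x))"
      using 1 mult_left_mono[OF 2 L] by linarith
    moreover have "f x - f (x - d/2) \<ge> L * (L * (f (x + d) - f (x + d/2)))"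
      using 2 mult_left_mono[OF 3 L] by linarith
    moreover have "K ^ 2 ^ Suc n = L * L"
      by (simp add: L_def mult_2 power_add)
    ultimately show ?case
      by (simp add: algebra_simps)
  qed
  define m where "m = (a + b) / 2"
  define d where "d = (b - a) / 2"
  have md: "m - d = a" "m + d = b" "a < m" "m < b" "0 < d"
    using \<open>a < b\<close> by (auto simp: m_def d_def field_simps)
  have pos: "f b - f m > 0"
    using strict_mono_onD[OF f, of m b] md by auto
  obtain n where n: "(f m - f a) / (f b - f m) < K ^ n"
    using real_arch_pow[OF \<open>1 < K\<close>] by blast
  have "K ^ n \<le> K ^ 2 ^ n"
    using \<open>1 < K\<close> by (intro power_increasing) (auto intro: less_imp_le)
  then have "(f m - f a) / (f b - f m) < K ^ 2 ^ n"
    using n by linarith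
  then have "f m - f a < K ^ 2 ^ n * (f b - f m)"
    using pos by (simp add: field_simps)
  with iter[of d m n] md show False by simp
qed

text \<open>By continuity the excess \<open>h\<close> of \<open>f\<close> over its chord attains a
  maximum on the segment. The chord is affine, so \<open>h\<close> inherits the midpoint inequality,
  and this rules out a positive maximum at the leftmost maximiser.\<close>

lemma midpoint_convex_imp_convex_on:
  fixes f :: "real \<Rightarrow> real"
  assumes "convex S" and cont: "continuous_on S f"
    and mid: "\<And>x d. 0 < d \<Longrightarrow> x - d \<in> S \<Longrightarrow> x + d \<in> S \<Longrightarrow> 2 * f x \<le> f (x - d) + f (x + d)"
  shows "convex_on S f"
proof (rule convex_on_linorderI)
  fix t x y :: real
  assume t: "0 < t" "t < 1" and xy: "x \<in> S" "y \<in> S" "x < y"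
  define l where "l s = (1 - s) * x + s * y" for s
  define h where "h s = f (l s) - ((1 - s) * f x + s * f y)" for s
  have lS: "l s \<in> S" if "s \<in> {0..1}" for s
    using convexD_alt[OF \<open>convex S\<close> xy(1,2)] that by (simp add: l_def)
  have conth: "continuous_on {0..1} h"
    unfolding h_def
    by (intro continuous_intros continuous_on_compose2[OF cont])
      (auto simp: l_def intro!: continuous_intros lS[unfolded l_def])
  obtain m where m: "m \<in> {0..1}" "\<And>s. s \<in> {0..1} \<Longrightarrow> h s \<le> h m"
    using continuous_attains_sup[of "{0..1::real}" h] conth by auto
  define Z where "Z = {s \<in> {0..1}. h s = h m}"
  have "closed Z"
    unfolding Z_def by (rule continuous_closed_preimage_constant[OF conth]) simp
  then have "compact Z"
    by (rule compact_Int_closed[OF compact_Icc, of _ 0 1, THEN back_subst[of compact]])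
      (auto simp: Z_def)
  then obtain s where s: "s \<in> Z" "\<And>r. r \<in> Z \<Longrightarrow> s \<le> r"
    using compact_attains_inf[of Z] m(1) by (auto simp: Z_def)
  have ends: "h 0 = 0" "h 1 = 0" by (auto simp: h_def l_def)
  have "h m \<le> 0"
  proof (rule ccontr)
    assume "\<not> h m \<le> 0"
    then have s01: "0 < s" "s < 1"
      using s(1) ends by (auto simp: Z_def less_le)
    \<comment> \<open>The maximiser \<open>s\<close> is interior, so a symmetric step fits. At
      \<open>s - d\<close> the value is strictly below the maximum because \<open>s\<close> is
      leftmost, and at \<open>s + d\<close> it is at most the maximum.\<close>
    define d where "d = min s (1 - s)"
    have d: "0 < d" "s - d \<in> {0..1}" "s + d \<in> {0..1}"
      using s01 by (auto simp: d_def)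
    define e where "e = d * (y - x)"
    have le: "l (s - d) = l s - e" "l (s + d) = l s + e"
      by (auto simp: l_def e_def algebra_simps)
    have "2 * f (l s) \<le> f (l (s - d)) + f (l (s + d))"
      using mid[of e "l s"] lS[OF d(2)] lS[OF d(3)] d(1) xy(3) unfolding le
      by (auto simp: e_def)
    then have "2 * h s \<le> h (s - d) + h (s + d)"
      by (simp add: h_def algebra_simps)
    moreover have "h (s - d) < h m"
      using s(2)[of "s - d"] d m(2)[OF d(2)] by (force simp: Z_def less_le)
    ultimately show False
      using m(2)[OF d(3)] s(1) by (simp add: Z_def)
  qed
  with m(2)[of t] t show "f ((1 - t) *\<^sub>R x + t *\<^sub>R y) \<le> (1 - t) * f x + t * f y"
    by (simp add: h_def l_def)
qed fact

section \<open>Closure properties of acts\<close>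

lemma acts_add: "X \<in> acts F \<Longrightarrow> Y \<in> acts F \<Longrightarrow> (\<lambda>\<omega>. X \<omega> + Y \<omega>) \<in> acts F"
  unfolding acts_def bounded_iff
  by (auto intro!: exI[of _ "_ + _"] order_trans[OF abs_triangle_ineq] add_mono)

lemma acts_const: "(\<lambda>_. c) \<in> acts F"
  by (auto simp: acts_def bounded_iff)

lemma acts_mult: "X \<in> acts F \<Longrightarrow> (\<lambda>\<omega>. c * X \<omega>) \<in> acts F"
  unfolding acts_def bounded_iff
  by (auto simp: abs_mult intro!: exI[of _ "\<bar>c\<bar> * _"] mult_left_mono)

lemma acts_indicator: "A \<in> sets F \<Longrightarrow> indicator A \<in> acts F"
  unfolding acts_def bounded_iff by (auto intro!: exI[of _ 1] simp: indicator_def)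

lemma acts_sum: "(\<And>i. i \<in> I \<Longrightarrow> X i \<in> acts F) \<Longrightarrow> (\<lambda>\<omega>. \<Sum>i\<in>I. X i \<omega>) \<in> acts F"
  by (induction I rule: infinite_finite_induct) (auto intro: acts_const acts_add)

lemma acts_bound:
  assumes "X \<in> acts F"
  obtains K where "0 < K" "\<And>\<omega>. \<omega> \<in> space F \<Longrightarrow> \<bar>X \<omega>\<bar> \<le> K"
  using assms by (auto simp: acts_def bounded_pos)

lemma acts_compose_mono:
  assumes X: "X \<in> acts F" and u: "mono u"
  shows "u \<circ> X \<in> acts F"
proof -
  obtain K where K: "\<And>\<omega>. \<omega> \<in> space F \<Longrightarrow> \<bar>X \<omega>\<bar> \<le> K"
    using acts_bound[OF X] by blast
  have "\<bar>u (X \<omega>)\<bar> \<le> max \<bar>u (- K)\<bar> \<bar>u K\<bar>" if "\<omega> \<in> space F" for \<omega>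
    using monoD[OF u, of "- K" "X \<omega>"] monoD[OF u, of "X \<omega>" K] K[OF that] by (auto simp: abs_le_iff)
  moreover have "u \<circ> X \<in> borel_measurable F"
    using X borel_measurable_mono[OF u] by (auto simp: acts_def intro: measurable_comp)
  ultimately show ?thesis
    by (auto simp: acts_def bounded_iff)
qed

lemma acts_subalgebra: "subalgebra F P \<Longrightarrow> X \<in> acts P \<Longrightarrow> X \<in> acts F"
  using measurable_from_subalg by (auto simp: acts_def subalgebra_def)

section \<open>The Choquet integral of a monotone set function\<close>

lemma integrable_indicator_Ico: "integrable lborel (indicator {a..<b :: real} :: real \<Rightarrow> real)"
  by (intro integrable_real_indicator emeasure_bounded_finite bounded_subset[OF bounded_closed_interval[of a b]])
    auto

text \<open>The total mass is left free so that the locale covers both the distorted capacity and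
  the restriction of \<open>\<mu>\<close> to a set \<open>A\<close>, whose total is
  \<open>\<mu> A\<close>.\<close>

locale monotone_set_function =
  fixes F :: "'a measure" and \<mu> :: "'a set \<Rightarrow> real"
  assumes empty: "\<mu> {} = 0"
    and mono: "A \<in> sets F \<Longrightarrow> B \<in> sets F \<Longrightarrow> A \<subseteq> B \<Longrightarrow> \<mu> A \<le> \<mu> B"
begin

text \<open>The two integrands of the Choquet integral merged into one function on the line, with
  the total mass in place of 1. For an act it vanishes outside a bounded interval.\<close>

definition layer :: "('a \<Rightarrow> real) \<Rightarrow> real \<Rightarrow> real" where
  "layer X x = \<mu> {\<omega> \<in> space F. X \<omega> > x} - \<mu> (space F) * indicator {..<0} x"

definition choquet :: "('a \<Rightarrow> real) \<Rightarrow> real" where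
  "choquet X = (LINT x|lborel. layer X x)"

lemma sets_upper: "X \<in> acts F \<Longrightarrow> {\<omega> \<in> space F. X \<omega> > x} \<in> sets F"
  by (auto simp: acts_def)

lemma nonneg: "A \<in> sets F \<Longrightarrow> 0 \<le> \<mu> A"
  using mono[of "{}" A] by (simp add: empty)

lemma le_total: "A \<in> sets F \<Longrightarrow> \<mu> A \<le> \<mu> (space F)"
  using mono[of A "space F"] sets.sets_into_space[of A F] by simp

lemma layer_measurable:
  assumes X: "X \<in> acts F"
  shows "layer X \<in> borel_measurable borel"
proof -
  have "mono (\<lambda>x. - \<mu> {\<omega> \<in> space F. X \<omega> > x})"
    by (rule monoI) (auto intro!: mono sets_upper[OF X])
  then have "(\<lambda>x. - (- \<mu> {\<omega> \<in> space F. X \<omega> > x})) \<in> borel_measurable borel"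
    by (intro borel_measurable_uminus borel_measurable_mono)
  then show ?thesis
    unfolding layer_def[abs_def] by simp
qed

lemma layer_integrable:
  assumes X: "X \<in> acts F"
  shows "integrable lborel (layer X)"
proof -
  obtain K where K: "0 < K" "\<And>\<omega>. \<omega> \<in> space F \<Longrightarrow> \<bar>X \<omega>\<bar> \<le> K"
    using acts_bound[OF X] by blast
  have zero: "layer X x = 0" if "x \<notin> {-K..<K}" for x
  proof (cases "x < 0")
    case True
    with that K have "{\<omega> \<in> space F. X \<omega> > x} = space F" by force
    with True show ?thesis by (simp add: layer_def)
  next
    case False
    with that K have *: "{\<omega> \<in> space F. X \<omega> > x} = {}" by force
    show ?thesis unfolding layer_def * empty using False by simp
  qed
  have "integrable lborel (\<lambda>x. \<mu> (space F) * indicator {-K..<K} x)"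
    by (intro integrable_mult_right integrable_indicator_Ico)
  then show ?thesis
  proof (rule Bochner_Integration.integrable_bound)
    show "layer X \<in> borel_measurable lborel"
      using layer_measurable[OF X] by simp
    show "AE x in lborel. norm (layer X x) \<le> norm (\<mu> (space F) * indicator {-K..<K} x)"
    proof (rule AE_I2)
      fix x
      show "norm (layer X x) \<le> norm (\<mu> (space F) * indicator {-K..<K} x)"
        using zero[of x] nonneg[OF sets_upper[OF X, of x]] le_total[OF sets_upper[OF X, of x]]
        by (cases "x \<in> {-K..<K}") (auto simp: layer_def indicator_def)
    qed
  qed
qed

lemma choquet_eq:
  assumes X: "X \<in> acts F" and "\<mu> (space F) = 1"
  shows "choquet_integral F \<mu> X = choquet X"
proof -
  let ?p = "\<lambda>x. indicator {0..} x *\<^sub>R \<mu> {\<omega> \<in> space F. X \<omega> > x}"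
  let ?n = "\<lambda>x. indicator {..0} x *\<^sub>R (\<mu> {\<omega> \<in> space F. X \<omega> > x} - 1)"
  have p: "?p x = indicator {0..} x * layer X x" for x
    using assms by (auto simp: layer_def indicator_def)
  \<comment> \<open>The half-lines in \<open>choquet_integral\<close> overlap at level 0, where
    \<open>layer\<close> subtracts nothing; that single point is a null set.\<close>
  have n: "AE x in lborel. ?n x = indicator {..<0} x * layer X x"
    using AE_lborel_singleton[of 0] by eventually_elim (use assms in \<open>auto simp: layer_def indicator_def\<close>)
  have meas: "(\<lambda>x. \<mu> {\<omega> \<in> space F. X \<omega> > x}) \<in> borel_measurable borel"
  proof -
    have "(\<lambda>x. layer X x + \<mu> (space F) * indicator {..<0} x) \<in> borel_measurable borel"
      using layer_measurable[OF X] by measurable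
    then show ?thesis by (simp add: layer_def)
  qed
  have "(LINT x|lborel. ?n x) = (LINT x|lborel. indicator {..<0} x * layer X x)"
    using meas layer_measurable[OF X] by (intro integral_cong_AE n) auto
  moreover have "(LINT x|lborel. indicator {0..} x * layer X x)
      + (LINT x|lborel. indicator {..<0} x * layer X x) = choquet X"
  proof -
    have "integrable lborel (\<lambda>x. indicator A x * layer X x)" if "A \<in> sets lborel" for A
      using integrable_mult_indicator[OF that layer_integrable[OF X]] by simp
    then have "(LINT x|lborel. indicator {0..} x * layer X x)
      + (LINT x|lborel. indicator {..<0} x * layer X x)
      = (LINT x|lborel. indicator {0..} x * layer X x + indicator {..<0} x * layer X x)"
      by (intro Bochner_Integration.integral_add[symmetric]) auto
    also have "\<dots> = choquet X"
      unfolding choquet_def by (intro Bochner_Integration.integral_cong) (auto simp: indicator_def)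
    finally show ?thesis .
  qed
  ultimately show ?thesis
    unfolding choquet_integral_def set_lebesgue_integral_def p by simp
qed

lemma choquet_mono:
  assumes "X \<in> acts F" "Y \<in> acts F" "\<And>\<omega>. \<omega> \<in> space F \<Longrightarrow> X \<omega> \<le> Y \<omega>"
  shows "choquet X \<le> choquet Y"
  unfolding choquet_def
proof (rule integral_mono)
  fix x
  have "\<mu> {\<omega> \<in> space F. X \<omega> > x} \<le> \<mu> {\<omega> \<in> space F. Y \<omega> > x}"
    using assms(3) by (intro mono sets_upper assms) force
  then show "layer X x \<le> layer Y x" by (simp add: layer_def)
qed (auto intro: layer_integrable assms)

lemma choquet_shift:
  assumes X: "X \<in> acts F"
  shows "choquet (\<lambda>\<omega>. X \<omega> + a) = choquet X + a * \<mu> (space F)"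
proof -
  have "choquet (\<lambda>\<omega>. X \<omega> + a) = (LINT x|lborel. layer (\<lambda>\<omega>. X \<omega> + a) (a + 1 * x))"
    unfolding choquet_def by (subst lborel_integral_real_affine[where c = 1 and t = a]) auto
  \<comment> \<open>After translating the levels by \<open>a\<close>, only the cut-off has moved,
    from 0 to \<open>-a\<close>. At most one of the two intervals is nonempty, and together they
    contribute the signed length \<open>a\<close>.\<close>
  also have "\<dots> = (LINT x|lborel. layer X x + \<mu> (space F) * (indicator {-a..<0} x - indicator {0..<-a} x))"
    by (intro Bochner_Integration.integral_cong)
      (auto simp: layer_def indicator_def less_diff_eq algebra_simps)
  also have "\<dots> = choquet X + \<mu> (space F) * (max a 0 - max (- a) 0)"
    unfolding choquet_def
    by (subst Bochner_Integration.integral_add)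
      (auto intro!: layer_integrable X integrable_mult_right Bochner_Integration.integrable_diff
        integrable_indicator_Ico
        simp: max_def)
  finally show ?thesis by (simp add: max_def mult.commute split: if_splits)
qed

lemma choquet_scale:
  assumes "0 \<le> c"
  shows "choquet (\<lambda>\<omega>. c * X \<omega>) = c * choquet X"
proof (cases "c = 0")
  case True
  have "layer (\<lambda>\<omega>. 0) x = 0" for x
    by (auto simp: layer_def indicator_def empty)
  with True show ?thesis by (simp add: choquet_def)
next
  case False
  then have "c > 0" using assms by simp
  have "choquet (\<lambda>\<omega>. c * X \<omega>) = \<bar>c\<bar> * (LINT x|lborel. layer (\<lambda>\<omega>. c * X \<omega>) (0 + c * x))"
    unfolding choquet_def using False by (subst lborel_integral_real_affine[where c = c and t = 0]) auto
  also have "(LINT x|lborel. layer (\<lambda>\<omega>. c * X \<omega>) (0 + c * x)) = choquet X"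
    unfolding choquet_def using \<open>c > 0\<close>
    by (intro Bochner_Integration.integral_cong) (auto simp: layer_def indicator_def mult_less_0_iff)
  finally show ?thesis using \<open>c > 0\<close> by simp
qed

text \<open>Since \<open>A\<close> lies in \<open>B\<close>, the upper level set is \<open>B\<close>
  for levels in \<open>{0..<b}\<close> and \<open>A\<close> for levels in
  \<open>{b..<b + a}\<close>. Up to a constant shift these are the three-outcome risks used
  below.\<close>

lemma choquet_step:
  assumes "A \<in> sets F" "B \<in> sets F" "A \<subseteq> B" "0 \<le> a" "0 \<le> b"
  shows "choquet (\<lambda>\<omega>. b * indicator B \<omega> + a * indicator A \<omega>) = b * \<mu> B + a * \<mu> A"
proof -
  have sub: "A \<subseteq> space F" "B \<subseteq> space F"
    using assms sets.sets_into_space by auto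
  have "layer (\<lambda>\<omega>. b * indicator B \<omega> + a * indicator A \<omega>) x
      = \<mu> B * indicator {0..<b} x + \<mu> A * indicator {b..<b + a} x" for x
  proof -
    let ?S = "{\<omega> \<in> space F. b * indicator B \<omega> + a * indicator A \<omega> > x}"
    consider "x < 0" | "0 \<le> x" "x < b" | "b \<le> x" "x < b + a" | "b + a \<le> x"
      by linarith
    then show ?thesis
    proof cases
      case 1
      then have "?S = space F"
        using assms by (auto simp: indicator_def)
      with 1 assms show ?thesis by (simp add: layer_def)
    next
      case 2
      then have "?S = B"
        using assms sub by (auto simp: indicator_def split: if_splits)
      with 2 assms show ?thesis by (simp add: layer_def)
    next
      case 3
      then have "?S = A"
        using assms sub by (auto simp: indicator_def split: if_splits)
      with 3 assms show ?thesis by (simp add: layer_def)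
    next
      case 4
      then have *: "?S = {}"
        using assms sub by (auto simp: indicator_def split: if_splits)
      show ?thesis unfolding layer_def * empty using 4 assms by simp
    qed
  qed
  then show ?thesis
    using assms by (simp add: choquet_def)
qed

text \<open>Supermodularity applied to \<open>{X > x}\<close> and \<open>A \<inter> {X > x - c}\<close> leaves, after integration, the
  effect of shifting \<open>X\<close> by \<open>c\<close> in the Choquet integral for the restriction of \<open>\<mu>\<close> to \<open>A\<close>.\<close>
lemma choquet_add_indicator:
  assumes super: "supermodular F \<mu>" and X: "X \<in> acts F" and A: "A \<in> sets F" and "0 \<le> c"
  shows "choquet (\<lambda>\<omega>. X \<omega> + c * indicator A \<omega>) \<ge> choquet X + c * \<mu> A"
proof -
  interpret A: monotone_set_function F "\<lambda>B. \<mu> (A \<inter> B)"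
    using A by unfold_locales (auto intro!: mono simp: empty)
  let ?Y = "\<lambda>\<omega>. X \<omega> + c * indicator A \<omega>"
  let ?Z = "\<lambda>\<omega>. X \<omega> + c"
  have Y: "?Y \<in> acts F" and Z: "?Z \<in> acts F"
    by (auto intro!: acts_add acts_mult acts_indicator acts_const X A)
  note int = layer_integrable[OF X] layer_integrable[OF Y] A.layer_integrable[OF X]
    A.layer_integrable[OF Z]
  have "(LINT x|lborel. layer X x + A.layer ?Z x) \<le> (LINT x|lborel. layer ?Y x + A.layer X x)"
  proof (rule integral_mono)
    fix x
    let ?S = "{\<omega> \<in> space F. X \<omega> > x}" and ?T = "A \<inter> {\<omega> \<in> space F. X \<omega> + c > x}"
    have "?S \<union> ?T = {\<omega> \<in> space F. ?Y \<omega> > x}" "?S \<inter> ?T = A \<inter> ?S"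
      using \<open>0 \<le> c\<close> by (auto simp: indicator_def split: if_splits)
    moreover have "?S \<in> sets F" "?T \<in> sets F"
      using A sets_upper[OF X] sets_upper[OF Z] by auto
    ultimately show "layer X x + A.layer ?Z x \<le> layer ?Y x + A.layer X x"
      using super unfolding supermodular_def layer_def A.layer_def by fastforce
  qed (use int in auto)
  then have "choquet X + A.choquet ?Z \<le> choquet ?Y + A.choquet X"
    using int by (simp add: choquet_def A.choquet_def)
  moreover have "A \<inter> space F = A"
    using sets.sets_into_space[OF A] by auto
  ultimately show ?thesis
    using A.choquet_shift[OF X, of c] by simp
qed

text \<open>An upper Riemann sum of mesh \<open>e\<close>: the mass of \<open>{Y > x}\<close>
  decreases in \<open>x\<close>, so its value at the left end of each cell dominates. Each summand
  has the form gained in \<open>choquet_add_indicator\<close>.\<close>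

lemma choquet_le_step_sum:
  assumes Y: "Y \<in> acts F" and "0 < e"
    and bound: "\<And>\<omega>. \<omega> \<in> space F \<Longrightarrow> 0 \<le> Y \<omega>" "\<And>\<omega>. \<omega> \<in> space F \<Longrightarrow> Y \<omega> \<le> real m * e"
  shows "choquet Y \<le> (\<Sum>k<m. e * \<mu> {\<omega> \<in> space F. Y \<omega> > real k * e})"
proof -
  let ?S = "\<lambda>x. {\<omega> \<in> space F. Y \<omega> > x}"
  let ?I = "\<lambda>k. {real k * e..<real (Suc k) * e}"
  have "choquet Y \<le> (LINT x|lborel. (\<Sum>k<m. \<mu> (?S (real k * e)) * indicator (?I k) x))"
    unfolding choquet_def
  proof (rule integral_mono)
    fix x
    have nn: "0 \<le> (\<Sum>k<m. \<mu> (?S (real k * e)) * indicator (?I k) x)"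
      by (intro sum_nonneg mult_nonneg_nonneg nonneg sets_upper[OF Y]) auto
    consider "x < 0" | "0 \<le> x" "x < real m * e" | "0 \<le> x" "real m * e \<le> x"
      by linarith
    then show "layer Y x \<le> (\<Sum>k<m. \<mu> (?S (real k * e)) * indicator (?I k) x)"
    proof cases
      case 1
      then have "?S x = space F" using bound(1) by force
      with 1 nn show ?thesis by (simp add: layer_def)
    next
      case 2
      define k where "k = nat \<lfloor>x / e\<rfloor>"
      have "real k \<le> x / e" "x / e < real k + 1"
        using 2 \<open>0 < e\<close> by (auto simp: k_def)
      then have k: "real k * e \<le> x" "x < real (Suc k) * e"
        using \<open>0 < e\<close> by (auto simp: field_simps)
      then have "real k * e < real m * e" using 2 by linarith
      then have "k < m" using \<open>0 < e\<close> by simp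
      have "layer Y x \<le> \<mu> (?S (real k * e)) * indicator (?I k) x"
        using 2 k by (auto simp: layer_def intro!: mono sets_upper[OF Y])
      also have "\<dots> \<le> (\<Sum>k<m. \<mu> (?S (real k * e)) * indicator (?I k) x)"
        using \<open>k < m\<close>
        by (intro member_le_sum mult_nonneg_nonneg nonneg sets_upper[OF Y]) auto
      finally show ?thesis .
    next
      case 3
      then have *: "?S x = {}" using bound(2) by force
      show ?thesis unfolding layer_def * empty using 3 nn by simp
    qed
  qed (intro layer_integrable[OF Y] Bochner_Integration.integrable_sum integrable_mult_right
      integrable_indicator_Ico)+
  also have "\<dots> = (\<Sum>k<m. e * \<mu> (?S (real k * e)))"
    using \<open>0 < e\<close> by (subst Bochner_Integration.integral_sum)
      (auto intro!: integrable_mult_right integrable_indicator_Ico simp: algebra_simps)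
  finally show ?thesis .
qed

text \<open>\<open>Y\<close> is replaced by the staircase \<open>T m\<close>, made of
  \<open>e\<close> times the indicators of its level sets, and these are added to \<open>X\<close>
  one at a time. The staircase exceeds \<open>Y\<close> by at most \<open>e\<close>, which costs
  \<open>e * \<mu> (space F)\<close>; then \<open>e\<close> tends to 0.\<close>

lemma choquet_superadditive_nonneg:
  assumes super: "supermodular F \<mu>" and X: "X \<in> acts F" and Y: "Y \<in> acts F"
    and Y0: "\<And>\<omega>. \<omega> \<in> space F \<Longrightarrow> 0 \<le> Y \<omega>"
  shows "choquet X + choquet Y \<le> choquet (\<lambda>\<omega>. X \<omega> + Y \<omega>)"
proof -
  have approx: "choquet X + choquet Y \<le> choquet (\<lambda>\<omega>. X \<omega> + Y \<omega>) + e * \<mu> (space F)"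
    if e: "0 < e" for e
  proof -
    define S where "S k = {\<omega> \<in> space F. Y \<omega> > real k * e}" for k
    have S: "S k \<in> sets F" for k
      using sets_upper[OF Y] by (simp add: S_def)
    define T where "T m \<omega> = (\<Sum>k<m. e * indicator (S k) \<omega>)" for m \<omega>
    have T: "T m \<in> acts F" for m
      unfolding T_def[abs_def] by (intro acts_sum acts_mult acts_indicator S)
    have lower: "choquet X + (\<Sum>k<m. e * \<mu> (S k)) \<le> choquet (\<lambda>\<omega>. X \<omega> + T m \<omega>)" for m
    proof (induction m)
      case 0
      show ?case by (simp add: T_def)
    next
      case (Suc m)
      show ?case
        using choquet_add_indicator[OF super acts_add[OF X T[of m]] S[of m], of e] Suc e
        by (simp add: T_def algebra_simps)
    qed
    obtain K where K: "\<And>\<omega>. \<omega> \<in> space F \<Longrightarrow> \<bar>Y \<omega>\<bar> \<le> K"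
      using acts_bound[OF Y] by blast
    \<comment> \<open>The levels must reach past the bound of \<open>Y\<close>, as
      \<open>choquet_le_step_sum\<close> requires.\<close>
    obtain m where "K / e \<le> real m"
      using real_arch_simple by blast
    then have m: "K \<le> real m * e"
      using e by (simp add: field_simps)
    \<comment> \<open>\<open>T m \<omega>\<close> is \<open>e\<close> times the number of
      \<open>k < m\<close> with \<open>real k * e < Y \<omega>\<close>, and there are at most
      \<open>Y \<omega> / e\<close> rounded up of them.\<close>
    have "T m \<omega> \<le> Y \<omega> + e" if \<omega>: "\<omega> \<in> space F" for \<omega>
    proof -
      define n where "n = nat \<lceil>Y \<omega> / e\<rceil>"
      have n: "real n \<le> Y \<omega> / e + 1" "Y \<omega> / e \<le> real n"
        using Y0[OF \<omega>] e by (auto simp: n_def)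
      have "T m \<omega> = (\<Sum>k | k < m \<and> \<omega> \<in> S k. e)"
        unfolding T_def by (intro sum.mono_neutral_cong_right) (auto simp: indicator_def)
      also have "\<dots> = real (card {k. k < m \<and> \<omega> \<in> S k}) * e" by simp
      also have "\<dots> \<le> real n * e"
      proof -
        have "{k. k < m \<and> \<omega> \<in> S k} \<subseteq> {..<n}"
        proof safe
          fix k assume "\<omega> \<in> S k"
          then have "real k < Y \<omega> / e" using e by (simp add: S_def field_simps)
          with n(2) show "k < n" by linarith
        qed
        then have "card {k. k < m \<and> \<omega> \<in> S k} \<le> n"
          using card_mono[of "{..<n}"] by fastforce
        then show ?thesis using e by simp
      qed
      also have "\<dots> \<le> Y \<omega> + e"
        using n(1) e by (simp add: field_simps)
      finally show ?thesis .
    qed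
    then have "choquet (\<lambda>\<omega>. X \<omega> + T m \<omega>) \<le> choquet (\<lambda>\<omega>. X \<omega> + Y \<omega> + e)"
      by (intro choquet_mono acts_add acts_const X Y T) (simp add: add.assoc)
    also have "\<dots> = choquet (\<lambda>\<omega>. X \<omega> + Y \<omega>) + e * \<mu> (space F)"
      by (rule choquet_shift[OF acts_add[OF X Y]])
    finally have "choquet X + (\<Sum>k<m. e * \<mu> (S k)) \<le> \<dots>"
      using lower[of m] by linarith
    moreover have "Y \<omega> \<le> real m * e" if "\<omega> \<in> space F" for \<omega>
      using K[OF that] m by linarith
    then have "choquet Y \<le> (\<Sum>k<m. e * \<mu> (S k))"
      unfolding S_def by (intro choquet_le_step_sum Y e Y0)
    ultimately show ?thesis by linarith
  qed
  show ?thesis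
  proof (rule field_le_epsilon)
    fix e :: real assume "0 < e"
    have total: "0 \<le> \<mu> (space F)" by (simp add: nonneg)
    \<comment> \<open>The added 1 avoids division by zero, as the total mass may vanish.\<close>
    have "e / (\<mu> (space F) + 1) * \<mu> (space F) \<le> e"
      using total \<open>0 < e\<close> by (simp add: field_simps)
    with approx[of "e / (\<mu> (space F) + 1)"] total \<open>0 < e\<close>
    show "choquet X + choquet Y \<le> choquet (\<lambda>\<omega>. X \<omega> + Y \<omega>) + e"
      by force
  qed
qed

text \<open>Adding a bound \<open>K\<close> to \<open>Y\<close> makes it nonnegative and raises both
  sides by the same amount.\<close>

lemma choquet_superadditive:
  assumes super: "supermodular F \<mu>" and X: "X \<in> acts F" and Y: "Y \<in> acts F"
  shows "choquet X + choquet Y \<le> choquet (\<lambda>\<omega>. X \<omega> + Y \<omega>)"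
proof -
  obtain K where K: "\<And>\<omega>. \<omega> \<in> space F \<Longrightarrow> \<bar>Y \<omega>\<bar> \<le> K"
    using acts_bound[OF Y] by blast
  have "choquet X + choquet (\<lambda>\<omega>. Y \<omega> + K) \<le> choquet (\<lambda>\<omega>. X \<omega> + (Y \<omega> + K))"
    using K by (intro choquet_superadditive_nonneg super X acts_add Y acts_const) (force simp: abs_le_iff)
  also have "\<dots> = choquet (\<lambda>\<omega>. X \<omega> + Y \<omega> + K)"
    by (simp add: add.assoc)
  finally show ?thesis
    by (simp add: choquet_shift Y acts_add[OF X Y])
qed

end

section \<open>Distorted capacities and sets of prescribed probability\<close>

lemma capacity_range:
  assumes "capacity F \<nu>" "S \<in> sets F"
  shows "\<nu> S \<in> {0..1}"
  using assms sets.sets_into_space[of S F]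
  unfolding capacity_def by (metis atLeastAtMost_iff empty_subsetI sets.empty_sets sets.top)

text \<open>Put \<open>d' = b + c - a\<close>, so that \<open>b\<close> and \<open>c\<close> lie
  between \<open>a\<close> and \<open>d'\<close> with the same sum. Convexity makes the outer pair
  have the larger sum of \<open>g\<close>-values, supermodularity says \<open>d' \<le> d\<close>,
  and monotonicity of \<open>g\<close> replaces \<open>d'\<close> by \<open>d\<close>.\<close>

lemma supermodular_compose:
  assumes super: "supermodular F \<nu>" and g: "convex_on {0..1} g" "mono_on {0..1} g"
    and cap: "capacity F \<nu>"
  shows "supermodular F (g \<circ> \<nu>)"
  unfolding supermodular_def
proof (intro ballI)
  fix A B assume AB: "A \<in> sets F" "B \<in> sets F"
  have mono: "\<nu> S \<le> \<nu> T" if "S \<in> sets F" "T \<in> sets F" "S \<subseteq> T" for S T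
    using cap that by (auto simp: capacity_def)
  define a b c d where "a = \<nu> (A \<inter> B)" and "b = \<nu> A" and "c = \<nu> B" and "d = \<nu> (A \<union> B)"
  define d' where "d' = b + c - a"
  have ord: "a \<le> b" "a \<le> c" "b \<le> d" "c \<le> d"
    using AB by (auto simp: a_def b_def c_def d_def intro!: mono)
  have "b + c \<le> d + a"
    using super AB by (auto simp: supermodular_def a_def b_def c_def d_def)
  then have "d' \<le> d" by (simp add: d'_def)
  have in01: "a \<in> {0..1}" "d \<in> {0..1}"
    using AB by (auto simp only: a_def d_def intro!: capacity_range[OF cap])
  have in01': "d' \<in> {0..1}" using in01 ord \<open>d' \<le> d\<close> by (auto simp: d'_def)
  have "g b + g c \<le> g a + g d'"
  proof (cases "a < d'")
    case True
    \<comment> \<open>The relative position of \<open>b\<close> in the interval from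
      \<open>a\<close> to \<open>d'\<close>; by symmetry \<open>c\<close> has position
      \<open>1 - t\<close>.\<close>
    define t where "t = (b - a) / (d' - a)"
    have t: "0 \<le> t" "t \<le> 1" "t * (d' - a) = b - a"
      using True ord by (auto simp: t_def d'_def field_simps)
    have "b = (1 - t) *\<^sub>R a + t *\<^sub>R d'" "c = (1 - (1 - t)) *\<^sub>R a + (1 - t) *\<^sub>R d'"
      using t(3) by (auto simp: d'_def algebra_simps)
    then have "g b \<le> (1 - t) * g a + t * g d'" "g c \<le> t * g a + (1 - t) * g d'"
      using convex_onD[OF g(1), of t a d'] convex_onD[OF g(1), of "1 - t" a d'] t in01 in01' by auto
    then show ?thesis by (simp add: algebra_simps)
  next
    case False
    then have "b = a" "c = a" "d' = a" using ord by (auto simp: d'_def)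
    then show ?thesis by simp
  qed
  also have "g d' \<le> g d"
    using mono_onD[OF g(2) in01' in01(2) \<open>d' \<le> d\<close>] .
  finally show "(g \<circ> \<nu>) A + (g \<circ> \<nu>) B \<le> (g \<circ> \<nu>) (A \<union> B) + (g \<circ> \<nu>) (A \<inter> B)"
    by (simp add: a_def b_def c_def d_def)
qed

lemma (in monotone_set_function) choquet_step_shift:
  assumes "A \<in> sets F" "B \<in> sets F" "A \<subseteq> B" "0 \<le> a" "0 \<le> b"
  shows "choquet (\<lambda>\<omega>. b * indicator B \<omega> + a * indicator A \<omega> + c)
    = b * \<mu> B + a * \<mu> A + c * \<mu> (space F)"
  using assms by (subst choquet_shift) (auto simp: choquet_step intro!: acts_add acts_mult acts_indicator)

lemma distorted_capacity:
  assumes "distortion_function g" "capacity F \<nu>"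
  shows "monotone_set_function F (g \<circ> \<nu>)"
proof
  show "(g \<circ> \<nu>) {} = 0" using assms by (simp add: distortion_function_def capacity_def)
next
  fix A B assume AB: "A \<in> sets F" "B \<in> sets F" "A \<subseteq> B"
  show "(g \<circ> \<nu>) A \<le> (g \<circ> \<nu>) B"
    using assms AB capacity_range[OF assms(2)]
    by (auto simp: distortion_function_def capacity_def simp del: atLeastAtMost_iff
        intro!: mono_onD[of "{0..1}" g])
qed

text \<open>Atomlessness yields subsets of a given set, so the largest set is chosen first.\<close>

lemma nested_sets_with_measure:
  assumes "prob_space P" "atomless P" "0 \<le> p" "p \<le> q" "q \<le> r" "r \<le> 1"
  obtains A B C where "A \<in> sets P" "B \<in> sets P" "C \<in> sets P" "A \<subseteq> B" "B \<subseteq> C"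
    "measure P A = p" "measure P B = q" "measure P C = r"
proof -
  interpret prob_space P by fact
  have sub: "\<exists>T\<in>sets P. T \<subseteq> S \<and> measure P T = t"
    if "S \<in> sets P" "t \<in> {0..measure P S}" for S t
    using assms(2) that unfolding atomless_def by (metis (no_types, lifting) imageE mem_Collect_eq)
  obtain C where C: "C \<in> sets P" "measure P C = r"
    using sub[of "space P" r] assms prob_space by auto
  obtain B where B: "B \<in> sets P" "B \<subseteq> C" "measure P B = q"
    using sub[of C q] assms C by auto
  obtain A where A: "A \<in> sets P" "A \<subseteq> B" "measure P A = p"
    using sub[of B p] assms B by auto
  show ?thesis using that A B C by blast
qed

section \<open>The capacity of the representation, and the shape of \<open>u\<close> and
  \<open>g\<close>\<close>

text \<open>This carries supermodularity over from the matching probability to the capacity in the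
  representation. Indicators are ranked by \<open>g (\<nu> S)\<close>, so indifference forces equal
  capacities, and on \<open>sets P\<close> the capacity is the probability.\<close>

lemma matching_probability_unique:
  assumes "subalgebra F P" and u: "strict_mono u" and g: "distortion_function g" "strict_mono_on {0..1} g"
    and cap: "capacity F \<nu>" and conf: "risk_conforming P \<nu>"
    and rep: "\<forall>X\<in>acts F. \<forall>Y\<in>acts F. R X Y \<longleftrightarrow>
      choquet_integral F (g \<circ> \<nu>) (u \<circ> X) \<ge> choquet_integral F (g \<circ> \<nu>) (u \<circ> Y)"
    and match: "matching_probability F P R \<nu>'" and A: "A \<in> sets F"
  shows "\<nu>' A = \<nu> A"
proof -
  interpret monotone_set_function F "g \<circ> \<nu>"
    by (rule distorted_capacity[OF g(1) cap])
  have total: "(g \<circ> \<nu>) (space F) = 1"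
    using g(1) cap by (simp add: distortion_function_def capacity_def)
  have u01: "u 1 - u 0 > 0"
    using strict_monoD[OF u, of 0 1] by simp
  have value_indicator: "choquet_integral F (g \<circ> \<nu>) (u \<circ> indicator S) = u 0 + (u 1 - u 0) * g (\<nu> S)"
    if S: "S \<in> sets F" for S
  proof -
    \<comment> \<open>The zero term brings the two-valued act into the nested form of
      \<open>choquet_step_shift\<close>, with both sets equal.\<close>
    have "u \<circ> indicator S = (\<lambda>\<omega>. (u 1 - u 0) * indicator S \<omega> + 0 * indicator S \<omega> + u 0)"
      by (auto simp: indicator_def)
    then show ?thesis
      using choquet_step_shift[OF S S subset_refl, of 0 "u 1 - u 0" "u 0"] u01 total
        choquet_eq[OF acts_compose_mono[OF acts_indicator[OF S] strict_mono_mono[OF u]] total] by simp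
  qed
  obtain B where B: "B \<in> sets P" "\<nu>' A = measure P B" "indifferent R (indicator A) (indicator B)"
    using match A by (auto simp: matching_probability_def)
  have BF: "B \<in> sets F" using B(1) \<open>subalgebra F P\<close> by (auto simp: subalgebra_def)
  have "choquet_integral F (g \<circ> \<nu>) (u \<circ> indicator A) = choquet_integral F (g \<circ> \<nu>) (u \<circ> indicator B)"
    using B(3) rep acts_indicator[OF A] acts_indicator[OF BF]
    unfolding indifferent_def by (meson antisym)
  then have "g (\<nu> A) = g (\<nu> B)"
    using u01 by (simp add: value_indicator A BF)
  then have "\<nu> A = \<nu> B"
    using strict_mono_on_imp_inj_on[OF g(2)] capacity_range[OF cap A] capacity_range[OF cap BF] by (auto dest: inj_onD)
  then show ?thesis
    using B(1,2) conf by (simp add: risk_conforming_def)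
qed

text \<open>Moving mass \<open>q\<close> from \<open>x\<close> up to \<open>x + d\<close> and equal mass down to \<open>x - d\<close> is a mean-preserving
  spread, so a strongly risk averse decision maker dislikes it.\<close>
lemma strong_risk_averse_increments:
  assumes "prob_space P" "subalgebra F P" "atomless P" and sra: "strong_risk_averse P R"
    and u: "strict_mono u" and g: "distortion_function g"
    and cap: "capacity F \<nu>" and conf: "risk_conforming P \<nu>"
    and rep: "\<forall>X\<in>acts F. \<forall>Y\<in>acts F. R X Y \<longleftrightarrow>
      choquet_integral F (g \<circ> \<nu>) (u \<circ> X) \<ge> choquet_integral F (g \<circ> \<nu>) (u \<circ> Y)"
    and "0 < d" "0 < q" "0 \<le> p - q" "p + q \<le> 1"
  shows "(u (x + d) - u x) * (g p - g (p - q)) \<le> (u x - u (x - d)) * (g (p + q) - g p)"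
proof -
  interpret prob_space P by fact
  interpret M: monotone_set_function F "g \<circ> \<nu>"
    by (rule distorted_capacity[OF g cap])
  have total: "(g \<circ> \<nu>) (space F) = 1"
    using g cap by (simp add: distortion_function_def capacity_def)
  obtain A B C where sets: "A \<in> sets P" "B \<in> sets P" "C \<in> sets P" and sub: "A \<subseteq> B" "B \<subseteq> C"
    and ms: "measure P A = p - q" "measure P B = p" "measure P C = p + q"
    using assms by (elim nested_sets_with_measure[of P "p - q" p "p + q"]) auto
  have setsF: "A \<in> sets F" "B \<in> sets F" "C \<in> sets F"
    using sets \<open>subalgebra F P\<close> by (auto simp: subalgebra_def)
  \<comment> \<open>\<open>X\<close> is \<open>x + d\<close> on \<open>A\<close>, \<open>x\<close>
    on \<open>C - A\<close> and \<open>x - d\<close> elsewhere. \<open>Y\<close> splits the middle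
    part, of mass \<open>2 * q\<close>, into \<open>x + d\<close> on \<open>B - A\<close> and
    \<open>x - d\<close> on \<open>C - B\<close>, each of mass \<open>q\<close>.\<close>
  define X where "X = (\<lambda>\<omega>. d * indicator C \<omega> + d * indicator A \<omega> + (x - d))"
  define Y where "Y = (\<lambda>\<omega>. 2 * d * indicator B \<omega> + (x - d))"
  \<comment> \<open>Stated for arbitrary \<open>f\<close>: a concave \<open>f\<close> gives the
    expectations, and \<open>f = u\<close> the Choquet integrals.\<close>
  have fX: "f (X \<omega>) = (f x - f (x - d)) * indicator C \<omega> + (f (x + d) - f x) * indicator A \<omega> + f (x - d)"
    for f :: "real \<Rightarrow> real" and \<omega>
    using sub by (auto simp: X_def indicator_def add.commute)
  have fY: "f (Y \<omega>) = (f (x + d) - f (x - d)) * indicator B \<omega> + f (x - d)"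
    for f :: "real \<Rightarrow> real" and \<omega>
    by (auto simp: Y_def indicator_def add.commute)
  have actsP: "X \<in> acts P" "Y \<in> acts P"
    unfolding X_def Y_def by (auto intro!: acts_add acts_mult acts_indicator acts_const sets)
  then have actsF: "X \<in> acts F" "Y \<in> acts F"
    using acts_subalgebra \<open>subalgebra F P\<close> by auto
  have "(\<integral>\<omega>. f (X \<omega>) \<partial>P) \<ge> (\<integral>\<omega>. f (Y \<omega>) \<partial>P)" if f: "concave_on UNIV f" for f
  proof -
    have "(1 - 1/2) * f (x - d) + 1/2 * f (x + d) \<le> f ((1 - 1/2) *\<^sub>R (x - d) + (1/2) *\<^sub>R (x + d))"
      by (intro concave_onD[OF f]) auto
    moreover have "(1 - 1/2) *\<^sub>R (x - d) + (1/2) *\<^sub>R (x + d) = x"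
      by (simp add: field_simps)
    ultimately have "f (x - d) + f (x + d) \<le> 2 * f x" by simp
    \<comment> \<open>The expectations of \<open>f\<close> under \<open>X\<close> and
      \<open>Y\<close> differ by exactly
      \<open>q * (2 * f x - f (x - d) - f (x + d))\<close>.\<close>
    then have "q * (f (x - d) + f (x + d)) \<le> q * (2 * f x)"
      using \<open>0 < q\<close> by (intro mult_left_mono) auto
    moreover have "(\<integral>\<omega>. f (X \<omega>) \<partial>P)
        = (f x - f (x - d)) * (p + q) + (f (x + d) - f x) * (p - q) + f (x - d)"
      unfolding fX using sets prob_space by (simp add: emeasure_eq_measure ms)
    moreover have "(\<integral>\<omega>. f (Y \<omega>) \<partial>P) = (f (x + d) - f (x - d)) * p + f (x - d)"
      unfolding fY using sets prob_space by (simp add: emeasure_eq_measure ms)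
    ultimately show ?thesis
      by (simp add: algebra_simps)
  qed
  then have "R X Y"
    using sra actsP by (auto simp: strong_risk_averse_def)
  then have "choquet_integral F (g \<circ> \<nu>) (u \<circ> X) \<ge> choquet_integral F (g \<circ> \<nu>) (u \<circ> Y)"
    using rep actsF by auto
  moreover have "choquet_integral F (g \<circ> \<nu>) (u \<circ> X)
      = (u x - u (x - d)) * g (p + q) + (u (x + d) - u x) * g (p - q) + u (x - d)"
  proof -
    have "M.choquet (u \<circ> X) = M.choquet (\<lambda>\<omega>. (u x - u (x - d)) * indicator C \<omega>
        + (u (x + d) - u x) * indicator A \<omega> + u (x - d))"
      by (simp add: comp_def fX)
    then show ?thesis
      using M.choquet_step_shift[OF setsF(1,3), of "u (x + d) - u x" "u x - u (x - d)" "u (x - d)"]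
        sub total conf sets ms \<open>0 < d\<close> strict_mono_less_eq[OF u]
        M.choquet_eq[OF acts_compose_mono[OF actsF(1) strict_mono_mono[OF u]] total]
      by (auto simp: risk_conforming_def)
  qed
  moreover have "choquet_integral F (g \<circ> \<nu>) (u \<circ> Y) = (u (x + d) - u (x - d)) * g p + u (x - d)"
  proof -
    have "M.choquet (u \<circ> Y) = M.choquet (\<lambda>\<omega>. (u (x + d) - u (x - d)) * indicator B \<omega>
        + 0 * indicator B \<omega> + u (x - d))"
      by (simp add: comp_def fY)
    then show ?thesis
      using M.choquet_step_shift[OF setsF(2,2), of 0 "u (x + d) - u (x - d)" "u (x - d)"]
        total conf sets ms \<open>0 < d\<close> strict_mono_less_eq[OF u]
        M.choquet_eq[OF acts_compose_mono[OF actsF(2) strict_mono_mono[OF u]] total]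
      by (auto simp: risk_conforming_def)
  qed
  ultimately show ?thesis
    by (simp add: algebra_simps)
qed

text \<open>A violation of the midpoint inequality by one function at a single place fixes a
  constant \<open>K > 1\<close>, and \<open>incr\<close> forces that ratio on the other function
  everywhere, against \<open>small_increment_ratio\<close>.\<close>

lemma increments_imp_concave_convex:
  fixes u g :: "real \<Rightarrow> real"
  assumes u: "strict_mono u" "continuous_on UNIV u"
    and g: "strict_mono_on {0..1} g" "continuous_on {0..1} g"
    and incr: "\<And>x d p q. 0 < d \<Longrightarrow> 0 < q \<Longrightarrow> 0 \<le> p - q \<Longrightarrow> p + q \<le> 1 \<Longrightarrow>
      (u (x + d) - u x) * (g p - g (p - q)) \<le> (u x - u (x - d)) * (g (p + q) - g p)"
  shows "concave_on UNIV u" "convex_on {0..1} g"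
proof -
  have u_pos: "u x < u y" if "x < y" for x y using strict_monoD[OF u(1) that] .
  have g_pos: "g p < g q" if "0 \<le> p" "p < q" "q \<le> 1" for p q
    using strict_mono_onD[OF g(1)] that by auto
  show "concave_on UNIV u"
    unfolding concave_on_def
  proof (rule midpoint_convex_imp_convex_on)
    fix x d :: real assume "0 < d"
    show "2 * - u x \<le> - u (x - d) + - u (x + d)"
    proof (rule ccontr)
      assume "\<not> ?thesis"
      then have less: "u x - u (x - d) < u (x + d) - u x" by simp
      have pos: "0 < u x - u (x - d)" using u_pos[of "x - d" x] \<open>0 < d\<close> by simp
      define K where "K = (u (x + d) - u x) / (u x - u (x - d))"
      have "1 < K" using less pos by (simp add: K_def)
      \<comment> \<open>For \<open>g\<close> the right increment has to be small relative to the
        left one. The reflection \<open>- g (1 - t)\<close> is still increasing and exchanges the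
        two.\<close>
      have "strict_mono_on {0..1} (\<lambda>t. - g (1 - t))"
        by (rule strict_mono_onI) (auto intro!: g_pos)
      then obtain t q where t: "0 < q" "0 \<le> t - q" "t + q \<le> 1"
        "- g (1 - t) - (- g (1 - (t - q))) < K * (- g (1 - (t + q)) - (- g (1 - t)))"
        using small_increment_ratio[of 0 1 "\<lambda>t. - g (1 - t)" K] \<open>1 < K\<close> by auto
      have "1 - (t - q) = (1 - t) + q" "1 - (t + q) = (1 - t) - q" by auto
      with t(4) have "g ((1 - t) + q) - g (1 - t) < K * (g (1 - t) - g ((1 - t) - q))"
        by simp
      then have "(u x - u (x - d)) * (g ((1 - t) + q) - g (1 - t))
          < (u x - u (x - d)) * (K * (g (1 - t) - g ((1 - t) - q)))"
        using pos by (rule mult_strict_left_mono)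
      also have "\<dots> = (u (x + d) - u x) * (g (1 - t) - g ((1 - t) - q))"
        using pos by (simp add: K_def)
      finally show False
        using incr[of d q "1 - t" x] t(1-3) \<open>0 < d\<close> by simp
    qed
  qed (use u in \<open>auto intro!: continuous_intros\<close>)
  show "convex_on {0..1} g"
  proof (rule midpoint_convex_imp_convex_on)
    fix p q :: real assume pq: "0 < q" "p - q \<in> {0..1}" "p + q \<in> {0..1}"
    show "2 * g p \<le> g (p - q) + g (p + q)"
    proof (rule ccontr)
      assume "\<not> ?thesis"
      then have less: "g (p + q) - g p < g p - g (p - q)" by simp
      have pos: "0 < g (p + q) - g p" using g_pos[of p "p + q"] pq by simp
      define K where "K = (g p - g (p - q)) / (g (p + q) - g p)"
      have "1 < K" using less pos by (simp add: K_def)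
      obtain x d where x: "0 < d" "u x - u (x - d) < K * (u (x + d) - u x)"
        using small_increment_ratio[of 0 1 u K] \<open>1 < K\<close> strict_mono_onI[of "{0..1}" u] u_pos by auto
      then have "(u x - u (x - d)) * (g (p + q) - g p)
          < K * (u (x + d) - u x) * (g (p + q) - g p)"
        using pos by (intro mult_strict_right_mono)
      also have "\<dots> = (u (x + d) - u x) * (g p - g (p - q))"
        using pos by (simp add: K_def)
      finally show False
        using incr[of d q p x] pq x(1) by simp
    qed
  qed (use g in auto)
qed

section \<open>Concavity of the representing functional\<close>

text \<open>Positive homogeneity and superadditivity make the Choquet integral concave; concavity of
  \<open>u\<close> bounds the mixture of utilities pointwise by the utility of the mixture, and
  monotonicity combines the two.\<close>

lemma (in monotone_set_function) concave_utility_choquet_concave: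
  assumes super: "supermodular F \<mu>" and u: "mono u" "concave_on UNIV u"
    and X: "X \<in> acts F" and Y: "Y \<in> acts F" and c: "c \<in> {0..1}"
  shows "choquet (u \<circ> (\<lambda>\<omega>. c * X \<omega> + (1 - c) * Y \<omega>)) \<ge> c * choquet (u \<circ> X) + (1 - c) * choquet (u \<circ> Y)"
proof -
  have uX: "u \<circ> X \<in> acts F" and uY: "u \<circ> Y \<in> acts F"
    by (intro acts_compose_mono X Y u(1))+
  have "c * choquet (u \<circ> X) + (1 - c) * choquet (u \<circ> Y)
      = choquet (\<lambda>\<omega>. c * (u \<circ> X) \<omega>) + choquet (\<lambda>\<omega>. (1 - c) * (u \<circ> Y) \<omega>)"
    using c by (simp only: choquet_scale atLeastAtMost_iff diff_ge_0_iff_ge)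
  also have "\<dots> \<le> choquet (\<lambda>\<omega>. c * (u \<circ> X) \<omega> + (1 - c) * (u \<circ> Y) \<omega>)"
    by (intro choquet_superadditive super acts_mult uX uY)
  also have "\<dots> \<le> choquet (u \<circ> (\<lambda>\<omega>. c * X \<omega> + (1 - c) * Y \<omega>))"
  proof (rule choquet_mono)
    fix \<omega>
    show "c * (u \<circ> X) \<omega> + (1 - c) * (u \<circ> Y) \<omega> \<le> (u \<circ> (\<lambda>\<omega>. c * X \<omega> + (1 - c) * Y \<omega>)) \<omega>"
      using concave_onD[OF u(2), of "1 - c" "X \<omega>" "Y \<omega>"] c by simp
  qed (auto intro!: acts_add acts_mult acts_compose_mono u X Y uX[unfolded comp_def] uY[unfolded comp_def])
  finally show ?thesis .
qed

theorem theorem4: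
  fixes F P :: "'a measure"
    and R :: "('a \<Rightarrow> real) \<Rightarrow> ('a \<Rightarrow> real) \<Rightarrow> bool"
    and \<nu> :: "'a set \<Rightarrow> real"
  assumes "prob_space P" and "subalgebra F P" and "atomless P"
    and "CRDU_preference F P R"
    and "strong_risk_averse P R"
    and "matching_probability F P R \<nu>" and "supermodular F \<nu>"
  shows "diversification_seeking F R"
proof -
  obtain u g \<nu>' where u: "continuous_on UNIV u" "strict_mono u"
    and g: "distortion_function g" "continuous_on {0..1} g" "strict_mono_on {0..1} g"
    and \<nu>': "continuous_capacity F \<nu>'" "risk_conforming P \<nu>'"
    and rep: "\<forall>X\<in>acts F. \<forall>Y\<in>acts F. R X Y \<longleftrightarrow>
      choquet_integral F (g \<circ> \<nu>') (u \<circ> X) \<ge> choquet_integral F (g \<circ> \<nu>') (u \<circ> Y)"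
    using assms(4) unfolding CRDU_preference_def by blast
  have cap: "capacity F \<nu>'" using \<nu>'(1) by (simp add: continuous_capacity_def)
  have "supermodular F \<nu>'"
    using assms(7) matching_probability_unique[OF assms(2) u(2) g(1,3) cap \<nu>'(2) rep assms(6)]
    by (simp add: supermodular_def)
  note incr = strong_risk_averse_increments[OF assms(1-3,5) u(2) g(1) cap \<nu>'(2) rep]
  have "concave_on UNIV u" "convex_on {0..1} g"
    using increments_imp_concave_convex[OF u(2,1) g(3,2) incr] by auto
  interpret monotone_set_function F "g \<circ> \<nu>'"
    by (rule distorted_capacity[OF g(1) cap])
  have super: "supermodular F (g \<circ> \<nu>')"
    using supermodular_compose[OF \<open>supermodular F \<nu>'\<close> \<open>convex_on {0..1} g\<close> _ cap] g(1)
    by (simp add: distortion_function_def)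
  have total: "(g \<circ> \<nu>') (space F) = 1"
    using g(1) cap by (simp add: distortion_function_def capacity_def)
  have mono_u: "mono u" using u(2) by (rule strict_mono_mono)
  have rep': "R X Y \<longleftrightarrow> choquet (u \<circ> X) \<ge> choquet (u \<circ> Y)" if "X \<in> acts F" "Y \<in> acts F" for X Y
    using rep that by (simp add: choquet_eq[OF acts_compose_mono[OF _ mono_u] total])
  show ?thesis
    unfolding diversification_seeking_def
  proof (intro ballI impI)
    fix X Y and c :: real
    assume X: "X \<in> acts F" and Y: "Y \<in> acts F" and c: "c \<in> {0..1}" and "indifferent R X Y"
    then have eq: "choquet (u \<circ> Y) = choquet (u \<circ> X)"
      using rep' by (auto simp: indifferent_def)
    have "(\<lambda>\<omega>. c * X \<omega> + (1 - c) * Y \<omega>) \<in> acts F"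
      by (intro acts_add acts_mult X Y)
    \<comment> \<open>By indifference the mixture of the two values is the value of \<open>X\<close>
      itself.\<close>
    moreover have "choquet (u \<circ> X) \<le> choquet (u \<circ> (\<lambda>\<omega>. c * X \<omega> + (1 - c) * Y \<omega>))"
      using concave_utility_choquet_concave[OF super mono_u \<open>concave_on UNIV u\<close> X Y c] eq
      by (simp add: algebra_simps)
    ultimately show "R (\<lambda>\<omega>. c * X \<omega> + (1 - c) * Y \<omega>) X"
      using rep' X by simp
  qed
qed

end
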